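(* Let $q$ be a prime power. Let $S \subseteq \mathbb{F}_{q^2}^*$ with $S=-S$ be such that $$\big|SSSS^{-1}S^{-1}S^{-1}\big|\leq \frac{q^2-3}{2} \quad \text{or} \quad \big|SS^{-1}S^{-1}\mathbb{F}_q^*\big|\leq \frac{q^2-1}{2}.$$ If $A\subseteq \mathbb{F}_{q^2}$ satisfies $|A|=q$, $0,1\in A$, and $A-A \subseteq S \cup \{0\}$, then $A$ is the subfield $\mathbb{F}_q$ of $\mathbb{F}_{q^2}$. Equivalently, if $A\subseteq \mathbb{F}_{q^2}$ is a clique in the Cayley graph $\operatorname{Cay}(\mathbb{F}_{q^2}; S)$ with $|A|=q$ and $0,1\in A$, then $A$ is the subfield $\mathbb{F}_q$.
   Context: $\mathbb{F}_r$ is the finite field with $r$ elements, $\mathbb{F}_r^*=\mathbb{F}_r\setminus\{0\}$, and $\mathbb{F}_q$ is regarded as the unique subfield of order $q$ of $\mathbb{F}_{q^2}$. For subsets $A,B$ of a finite field, $A-B=\{a-b: a\in A, b\in B\}$, $-A=\{-a: a\in A\}$, $AB=\{ab: a\in A, b\in B\}$ (iterated products, such as $SSSS^{-1}S^{-1}S^{-1}$, are product sets of several factors), and, if $0\notin A$, $A^{-1}=\{a^{-1}: a\in A\}$. For an abelian group $G$ and $S\subseteq G\setminus\{0\}$ with $S=-S$, the Cayley graph $\operatorname{Cay}(G;S)$ has vertex set $G$, with two vertices adjacent if and only if their difference lies in $S$; here $G$ is the additive group of $\mathbb{F}_{q^2}$. A clique is a set of pairwise adjacent vertices, so $A$ is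 a clique if and only if $A-A\subseteq S\cup\{0\}$. *)

theory Defs
  imports
    "HOL-Number_Theory.Prime_Powers"
    "HOL-Computational_Algebra.Polynomial"
    "HOL-Library.Set_Algebras"
    "HOL-Library.Ramsey"
    "HOL-Library.Cardinality"
begin

text \<open>
  Product sets are the pointwise products of sets from \<^theory>\<open>HOL-Library.Set_Algebras\<close>.
  On sets, \<open>A - B\<close> and \<open>- A\<close> are set difference and complement, so the difference set
  gets a name of its own, and the pointwise negative and inverse of \<open>A\<close> are written
  \<open>uminus ` A\<close> and \<open>inverse ` A\<close>.
\<close>

definition difference_set :: "'a::minus set \<Rightarrow> 'a set \<Rightarrow> 'a set" where
  "difference_set A B = {a - b | a b. a \<in> A \<and> b \<in> B}"

definition is_subfield :: "'a::field set \<Rightarrow> bool" where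
  "is_subfield K \<longleftrightarrow> 0 \<in> K \<and> 1 \<in> K \<and>
     (\<forall>x\<in>K. \<forall>y\<in>K. x + y \<in> K \<and> x * y \<in> K) \<and>
     (\<forall>x\<in>K. - x \<in> K) \<and> (\<forall>x\<in>K. x \<noteq> 0 \<longrightarrow> inverse x \<in> K)"

text \<open>
  The subfield of order \<open>q\<close>; it exists and is unique if the ambient field has \<open>q\<^sup>2\<close>
  elements, see \<open>ex1_subfield_of_order\<close> below.
\<close>

definition subfield_of_order :: "nat \<Rightarrow> 'a::field set" where
  "subfield_of_order q = (THE K. is_subfield K \<and> card K = q)"

text \<open>
  Edges of the Cayley graph on the additive group of the type \<open>'a\<close> (all elements of the type
  are vertices), in the form expected by \<^const>\<open>clique\<close>. For \<open>S = uminus ` S\<close> and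
  \<open>0 \<notin> S\<close> this is a simple graph.
\<close>

definition cayley_edges :: "'a::ab_group_add set \<Rightarrow> 'a set set" where
  "cayley_edges S = {{x, y} | x y. x - y \<in> S}"

lemma clique_cayley_edges_iff:
  assumes "S = uminus ` S"
  shows "clique A (cayley_edges S) \<longleftrightarrow> difference_set A A \<subseteq> S \<union> {0}"
proof -
  have sym: "x - y \<in> S \<longleftrightarrow> y - x \<in> S" for x y
    using assms by (metis image_eqI minus_diff_eq)
  have "{x, y} \<in> cayley_edges S \<longleftrightarrow> x - y \<in> S" for x y
    unfolding cayley_edges_def using sym by (auto simp: doubleton_eq_iff)
  then show ?thesis
    unfolding clique_def difference_set_def by fastforce
qed

lemma subfield_power_card_eq_same:
  fixes K :: "'a::finite_field set"
  assumes K: "is_subfield K" and x: "x \<in> K"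
  shows "x ^ card K = x"
proof (cases "x = 0")
  case True
  have "card K > 0"
    using x by (auto simp: card_gt_0_iff)
  then show ?thesis
    using True by simp
next
  case False
  have "(\<Prod>y\<in>K - {0}. x * y) = (\<Prod>y\<in>K - {0}. y)"
    by (rule prod.reindex_bij_witness[of _ "\<lambda>y. inverse x * y" "\<lambda>y. x * y"])
       (use False K x in \<open>auto simp: is_subfield_def\<close>)
  then have "x ^ card (K - {0}) * \<Prod>(K - {0}) = \<Prod>(K - {0})"
    by (simp add: prod.distrib)
  moreover have "\<Prod>(K - {0}) \<noteq> 0"
    by simp
  ultimately have "x ^ card (K - {0}) = 1"
    by simp
  moreover have "card K = Suc (card (K - {0}))"
    using K by (metis card_Suc_Diff1 finite is_subfield_def)
  ultimately show ?thesis
    by simp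
qed

lemma ex1_subfield_of_order:
  assumes q: "primepow q" and card: "CARD('a::finite_field) = q ^ 2"
  shows "\<exists>!K :: 'a set. is_subfield K \<and> card K = q"
proof -
  obtain p k where p: "prime p" "k > 0" "q = p ^ k"
    using q by (auto simp: primepow_def)
  have q1: "q > 1"
    using primepow_gt_Suc_0[OF q] by simp
  have "(\<Sum>x\<in>UNIV. x + 1) = (\<Sum>x\<in>UNIV. x :: 'a)"
    by (rule sum.reindex_bij_witness[of _ "\<lambda>x. x - 1" "\<lambda>x. x + 1"]) auto
  then have "of_nat CARD('a) = (0 :: 'a)"
    by (simp add: sum.distrib)
  then have "CHAR('a) dvd p ^ (k * 2)"
    using card p by (simp only: of_nat_eq_0_iff_char_dvd power_mult)
  then have "CHAR('a) = p"
    using CHAR_prime[where ?'a = 'a] p(1) by (meson prime_dvd_power primes_dvd_imp_eq)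
  then have qC: "q = CHAR('a) ^ k"
    using p by simp
  have add: "(x + y) ^ q = x ^ q + y ^ q" for x y :: 'a
    by (rule freshmans_dream'[OF CHAR_prime qC])
  have neg: "(- x) ^ q = - (x ^ q)" for x :: 'a
    using add[of x "- x"] q1 by (simp add: power_0_left eq_neg_iff_add_eq_0 add.commute)
  have diff: "(x - y) ^ q = x ^ q - y ^ q" for x y :: 'a
    using add[of x "- y"] neg by simp
  have qq: "(x ^ q) ^ q = x" for x :: 'a
    using finite_field_power_card_eq_same[of x] card
    by (simp add: power2_eq_square power_mult)
  define R where "R = {x :: 'a. x ^ q = x}"
  have deg: "degree (monom 1 q + [:0, c:] :: 'a poly) = q" for c
    using q1 by (subst degree_add_eq_left) (auto simp: degree_monom_eq)
  have roots: "card {x :: 'a. x ^ q + c * x = 0} \<le> q" for c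
    using card_poly_roots_bound[of "monom 1 q + [:0, c:] :: 'a poly"] deg[of c] q1
    by (force simp: poly_monom mult.commute)
  have R_le: "card R \<le> q"
    using roots[of "-1"] by (simp add: R_def)
  define f where "f = (\<lambda>x :: 'a. x ^ q - x)"
  have "f ` UNIV \<subseteq> {x. x ^ q + 1 * x = 0}"
    by (auto simp: f_def diff qq)
  then have im: "card (range f) \<le> q"
    using roots[of 1] by (meson card_mono finite order_trans)
  have fib: "card {x. f x = f y} \<le> card R" for y
    by (rule card_inj_on_le[of "\<lambda>x. x - y"])
       (auto simp: inj_on_def R_def f_def diff algebra_simps)
  have "UNIV = (\<Union>z\<in>range f. {x. f x = z})"
    by auto
  then have "CARD('a) \<le> (\<Sum>z\<in>range f. card {x. f x = z})"
    using card_UN_le[of "range f" "\<lambda>z. {x. f x = z}"] by simp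
  also have "\<dots> \<le> card (range f) * card R"
    using sum_bounded_above[of "range f" "\<lambda>z. card {x. f x = z}" "card R"] fib by auto
  also have "\<dots> \<le> q * card R"
    using im by simp
  finally have "q \<le> card R"
    using card q1 by (simp add: power2_eq_square)
  with R_le have R_card: "card R = q"
    by simp
  have R_sub: "is_subfield R"
    using q1 by (auto simp: is_subfield_def R_def add neg power_mult_distrib power_inverse)
  show ?thesis
  proof (rule ex1I[of _ R])
    show "is_subfield R \<and> card R = q"
      using R_sub R_card by simp
  next
    fix K :: "'a set"
    assume K: "is_subfield K \<and> card K = q"
    then have "K \<subseteq> R"
      using subfield_power_card_eq_same[of K] by (auto simp: R_def)
    then show "K = R"
      using K R_card by (simp add: card_subset_eq)
  qed
qed

end

theory Submission
  imports Defs
begin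

text \<open>
  If every nonzero quotient of a difference of \<open>D\<close> by a difference of \<open>B\<close>, with
  \<open>|D| = |B| = q\<close>, lies in a set of at most \<open>(q\<^sup>2 - 1) / 2\<close> elements, then for at least half of the
  nonzero \<open>t\<close> the sums \<open>d + t b\<close> run through the whole field exactly once, so that
  \<open>\<Prod>(x - d - t b) = x\<^bsup>q\<^sup>2\<^esup> - x\<close>. The coefficient of \<open>x\<^bsup>j\<^esup>\<close> on the left has degree at most \<open>q\<^sup>2 - j\<close>
  in \<open>t\<close>; hence it vanishes identically for \<open>j\<close> large, and \<open>t = 0\<close> shows that
  \<open>\<Prod>(x - d)\<^bsup>q\<^esup>\<close>, and therefore \<open>\<Prod>(x - d)\<close>, has a gap below its leading term.
  This applies to \<open>D = A\<close> and, because
  \<open>1/a - 1/b = (b - a)/(ab)\<close>, also to \<open>D = {0} \<union> (A - {0})\<^bsup>-1\<^esup>\<close>, with \<open>B = D\<close> under the first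
  hypothesis and \<open>B\<close> the subfield under the second. Inversion reverses coefficients, so the
  two gaps together leave only \<open>\<Prod>\<^bsub>a\<in>A\<^esub>(x - a) = x\<^bsup>q\<^esup> + c x\<close>, and \<open>1 \<in> A\<close> forces \<open>c = -1\<close>.
\<close>

section \<open>Root polynomials and products of linear factors in two variables\<close>

definition root_poly :: "'a::comm_ring_1 set \<Rightarrow> 'a poly" where
  "root_poly A = (\<Prod>a\<in>A. [:- a, 1:])"

lemma degree_root_poly: "degree (root_poly (A :: 'a::idom set)) = card A"
  unfolding root_poly_def by (subst degree_prod_eq_sum_degree) auto

lemma monic_root_poly: "coeff (root_poly (A :: 'a::idom set)) (card A) = 1"
  using lead_coeff_prod[of "\<lambda>a. [:- a, 1:]" A]
  by (simp add: root_poly_def flip: degree_root_poly)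

lemma poly_root_poly_eq_0:
  assumes "finite A" "a \<in> A"
  shows "poly (root_poly A) a = 0"
  using assms by (auto simp: root_poly_def poly_prod intro!: prod_zero)

text \<open>Both sides are monic of degree \<open>CARD('a)\<close> and vanish at every field
  element, hence agree.\<close>

lemma root_poly_UNIV:
  "root_poly (UNIV :: 'a::finite_field set) = monom 1 CARD('a) - [:0, 1:]" (is "?L = ?R")
proof -
  have C1: "CARD('a) > 1"
    using card_mono[of "UNIV :: 'a set" "{0, 1}"] by simp
  show ?thesis
  proof (rule poly_eqI_degree_lead_coeff[where A = UNIV and n = "CARD('a)"])
    show "coeff ?L CARD('a) = coeff ?R CARD('a)"
      using C1 monic_root_poly[of "UNIV :: 'a set"] by (auto simp: coeff_pCons split: nat.split)
    show "degree ?R \<le> CARD('a)"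
      using C1 by (intro degree_diff_le) (auto simp: degree_monom_le)
    show "poly ?L x = poly ?R x" for x
      by (simp add: poly_root_poly_eq_0 poly_monom finite_field_power_card_eq_same)
  qed (auto simp: degree_root_poly)
qed

text \<open>Read in two variables, each factor has total degree at most 1, so the product has total
  degree at most \<open>card I\<close>.\<close>

lemma degree_coeff_prod_linear_le:
  fixes u :: "'i \<Rightarrow> 'a::comm_ring_1 poly"
  assumes "finite I" "\<And>i. i \<in> I \<Longrightarrow> degree (u i) \<le> 1"
  shows "degree (coeff (\<Prod>i\<in>I. [:u i, 1:]) j) \<le> card I - j"
  using assms
proof (induction I arbitrary: j rule: finite_induct)
  case empty
  then show ?case by simp
next
  case (insert i I)
  let ?P = "\<Prod>i\<in>I. [:u i, 1:]"
  have IH: "degree (coeff ?P k) \<le> card I - k" for k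
    using insert by simp
  \<comment> \<open>For \<open>k > card I\<close> the truncated bound \<open>IH\<close> still allows
    a nonzero constant, whose product with \<open>u i\<close> could have degree 1; exact vanishing
    rules this out.\<close>
  have van: "coeff ?P k = 0" if "k > card I" for k
  proof (rule coeff_eq_0)
    have "degree ?P \<le> (\<Sum>i\<in>I. degree [:u i, 1:])"
      using degree_prod_sum_le[of I "\<lambda>i. [:u i, 1:]"] insert by (simp add: o_def)
    also have "\<dots> \<le> (\<Sum>i\<in>I. 1)"
      by (rule sum_mono) simp
    finally show "degree ?P < k"
      using that by simp
  qed
  have 1: "degree (u i * coeff ?P j) \<le> Suc (card I) - j"
  proof (cases "j \<le> card I")
    case True
    have "degree (u i * coeff ?P j) \<le> 1 + (card I - j)"
      using degree_mult_le[of "u i" "coeff ?P j"] insert.prems[of i] IH[of j] by simp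
    then show ?thesis
      using True by simp
  qed (simp add: van)
  have 2: "degree (coeff (pCons 0 ?P) j) \<le> Suc (card I) - j"
    using IH[of "j - 1"] by (cases j) auto
  have "coeff (\<Prod>i\<in>insert i I. [:u i, 1:]) j = u i * coeff ?P j + coeff (pCons 0 ?P) j"
    using insert by simp
  then show ?case
    using degree_add_le[OF 1 2] insert by simp
qed

lemma poly_coeff_prod_linear:
  fixes u :: "'i \<Rightarrow> 'a::comm_ring_1 poly"
  shows "poly (coeff (\<Prod>i\<in>I. [:u i, 1:]) j) t = coeff (\<Prod>i\<in>I. [:poly (u i) t, 1:]) j"
proof (induction I arbitrary: j rule: infinite_finite_induct)
  case (insert i I)
  then show ?case
    by (cases j) auto
qed auto

section \<open>Frobenius powers\<close>

lemma CHAR_power_eq_of_primepow: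
  assumes q: "primepow q" and card: "CARD('a::finite_field) = q ^ 2"
  obtains k where "q = CHAR('a) ^ k"
proof -
  obtain p k where p: "prime p" "k > 0" "q = p ^ k"
    using q by (auto simp: primepow_def)
  \<comment> \<open>Translation by 1 permutes the field, so adding up 1 over all elements gives
    0.\<close>
  have "(\<Sum>x\<in>UNIV. x + 1) = (\<Sum>x\<in>UNIV. x :: 'a)"
    by (rule sum.reindex_bij_witness[of _ "\<lambda>x. x - 1" "\<lambda>x. x + 1"]) auto
  then have "of_nat CARD('a) = (0 :: 'a)"
    by (simp add: sum.distrib)
  then have "CHAR('a) dvd p ^ (k * 2)"
    using card p by (simp only: of_nat_eq_0_iff_char_dvd power_mult)
  then have "CHAR('a) = p"
    using CHAR_prime[where ?'a = 'a] p(1) by (meson prime_dvd_power primes_dvd_imp_eq)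
  with p that show thesis
    by blast
qed

text \<open>The \<open>q\<close>-th power map is additive, so it acts on \<open>f\<close> monomial
  by monomial.\<close>

lemma coeff_power_CHAR_power:
  fixes f :: "'a::finite_field poly"
  assumes "q = CHAR('a) ^ k"
  shows "coeff (f ^ q) (q * i) = coeff f i ^ q"
proof -
  have q: "q > 0"
    using assms CHAR_prime[where ?'a = 'a] by (simp add: prime_gt_0_nat)
  have "f ^ q = (\<Sum>j\<le>degree f. monom (coeff f j) j) ^ q"
    by (simp add: poly_as_sum_of_monoms)
  also have "\<dots> = (\<Sum>j\<le>degree f. monom (coeff f j) j ^ q)"
    by (rule freshmans_dream_sum') (use assms CHAR_prime[where ?'a = 'a] in auto)
  also have "\<dots> = (\<Sum>j\<le>degree f. monom (coeff f j ^ q) (q * j))"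
    by (simp add: monom_power mult.commute)
  finally have "coeff (f ^ q) (q * i) = (\<Sum>j\<le>degree f. if j = i then coeff f j ^ q else 0)"
    using q by (auto simp: coeff_sum intro!: sum.cong)
  also have "\<dots> = coeff f i ^ q"
    using q by (simp add: coeff_eq_0)
  finally show ?thesis .
qed

section \<open>The gap forced by few difference quotients\<close>

lemma coeff_root_poly_eq_0:
  fixes D B X :: "'a::finite_field set"
  assumes q: "primepow q" and card: "CARD('a) = q ^ 2"
    and D: "card D = q" and B: "card B = q"
    and X: "2 * card X \<le> q ^ 2 - 1"
    and ratio: "\<And>d d' b b'. \<lbrakk>d \<in> D; d' \<in> D; b \<in> B; b' \<in> B; d \<noteq> d'; b \<noteq> b'\<rbrakk> \<Longrightarrow>
       (d - d') / (b - b') \<in> X"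
    and j: "q < 2 * j" "j < q"
  shows "coeff (root_poly D) j = 0"
proof -
  have q1: "q > 1"
    using primepow_gt_Suc_0[OF q] by simp
  \<comment> \<open>With x the outer and t the inner variable, each factor is x - (d + t b).\<close>
  define P where "P = (\<Prod>(d, b)\<in>D \<times> B. [:[:- d, - b:], 1:])"
  have P: "P = (\<Prod>i\<in>D \<times> B. [:[:- fst i, - snd i:], 1:])"
    by (simp add: P_def case_prod_beta)
  have card_DB: "card (D \<times> B) = q ^ 2"
    using D B by (simp add: power2_eq_square)
  \<comment> \<open>A collision d + t b = d' + t b' of distinct pairs with t nonzero makes -t a
    quotient in \<open>X\<close>; \<open>C\<close> excludes such t.\<close>
  define C where "C = UNIV - {0} - uminus ` X"
  have "card (UNIV - {0 :: 'a}) = q ^ 2 - 1"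
    using card by (simp add: card_Diff_singleton)
  moreover have "card (UNIV - {0} - uminus ` X) \<ge> card (UNIV - {0 :: 'a}) - card (uminus ` X)"
    by (rule diff_card_le_card_Diff) simp
  moreover have "card (uminus ` X) = card X"
    by (rule card_image) simp
  ultimately have C: "2 * card C \<ge> q ^ 2 - 1"
    using X by (simp add: C_def)
  have "coeff P (q * j) = 0"
  proof (rule ccontr)
    assume nz: "coeff P (q * j) \<noteq> 0"
    have zero: "poly (coeff P (q * j)) t = 0" if t: "t \<in> C" for t
    proof -
      have inj: "inj_on (\<lambda>i. fst i + t * snd i) (D \<times> B)"
      proof (rule inj_onI)
        fix x y assume xy: "x \<in> D \<times> B" "y \<in> D \<times> B" "fst x + t * snd x = fst y + t * snd y"
        obtain d b where x: "x = (d, b)" by force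
        obtain d' b' where y: "y = (d', b')" by force
        have eq: "d - d' = - t * (b - b')"
          using xy x y by (simp add: algebra_simps)
        show "x = y"
        proof (rule ccontr)
          assume "x \<noteq> y"
          then have ne: "d \<noteq> d'" "b \<noteq> b'"
            using eq t x y by (auto simp: C_def)
          then have "(d - d') / (b - b') = - t"
            using eq by (simp add: field_simps)
          then have "- t \<in> X"
            using ratio[of d d' b b'] ne xy x y by auto
          then have "t \<in> uminus ` X"
            by (metis image_eqI minus_minus)
          then show False
            using t by (simp add: C_def)
        qed
      qed
      then have "card ((\<lambda>i. fst i + t * snd i) ` (D \<times> B)) = CARD('a)"
        using card_DB card by (simp add: card_image)
      then have im: "(\<lambda>i. fst i + t * snd i) ` (D \<times> B) = UNIV"
        by (simp add: card_subset_eq)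
      have "poly (coeff P (q * j)) t = coeff (\<Prod>i\<in>D \<times> B. [:- (fst i + t * snd i), 1:]) (q * j)"
        unfolding P poly_coeff_prod_linear by simp
      also have "(\<Prod>i\<in>D \<times> B. [:- (fst i + t * snd i), 1:]) = root_poly UNIV"
        unfolding root_poly_def by (subst im[symmetric], subst prod.reindex[OF inj]) simp
      also have "coeff (root_poly (UNIV :: 'a set)) (q * j) = 0"
      \<comment> \<open>\<open>root_poly UNIV\<close> is x^(q^2) - x, and \<open>q * j\<close> lies
        strictly between its two exponents.\<close>
      proof -
        have "q * 1 \<le> q * j"
          using j by (intro mult_left_mono) auto
        then have "1 < q * j"
          using q1 by linarith
        moreover have "q * j < q ^ 2"
          using j by (simp add: power2_eq_square)
        ultimately show ?thesis
          unfolding root_poly_UNIV card by (auto simp: coeff_pCons split: nat.split)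
      qed
      finally show ?thesis .
    qed
    have "card C \<le> card {t. poly (coeff P (q * j)) t = 0}"
      by (rule card_mono) (use zero in auto)
    also have "\<dots> \<le> degree (coeff P (q * j))"
      by (rule card_poly_roots_bound[OF nz])
    also have "\<dots> \<le> q ^ 2 - q * j"
      using degree_coeff_prod_linear_le[of "D \<times> B" "\<lambda>i. [:- fst i, - snd i:]" "q * j"] card_DB
      by (simp add: P)
    finally have "q ^ 2 - 1 \<le> 2 * (q ^ 2 - q * j)"
      using C by simp
    \<comment> \<open>Since q + 1 \<le> 2j, twice the degree bound is at most q^2 - q, which is
      below q^2 - 1.\<close>
    moreover have "q * (q + 1) \<le> q * (2 * j)"
      by (rule mult_left_mono) (use j in auto)
    moreover have "q * j < q ^ 2"
      using j by (simp add: power2_eq_square)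
    ultimately show False
      using q1 unfolding power2_eq_square distrib_left mult.left_commute[of q 2] by linarith
  qed
  \<comment> \<open>At t = 0 the factors no longer involve b, so each x - d occurs
    \<open>card B\<close> = q times.\<close>
  then have "poly (coeff P (q * j)) 0 = 0"
    by simp
  then have "coeff (\<Prod>i\<in>D \<times> B. [:- fst i, 1:]) (q * j) = 0"
    unfolding P poly_coeff_prod_linear by simp
  moreover have "(\<Prod>i\<in>D \<times> B. [:- fst i, 1:]) = root_poly D ^ q"
    using prod.cartesian_product[of "\<lambda>d b. [:- d, 1:]" B D] B
    by (simp add: root_poly_def prod_power_distrib case_prod_beta)
  ultimately have "coeff (root_poly D) j ^ q = 0"
    by (metis CHAR_power_eq_of_primepow[OF q card] coeff_power_CHAR_power)
  then show ?thesis
    by simp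
qed

section \<open>Reversal of coefficients and recognition of the subfield\<close>

text \<open>Since \<open>inverse 0 = 0\<close>, the set \<open>inverse ` A\<close> is \<open>{0} \<union> (A - {0})\<^bsup>-1\<^esup>\<close>.\<close>

lemma coeff_root_poly_inverse:
  fixes A :: "'a::field set"
  assumes A: "finite A" "0 \<in> A" and j: "1 \<le> j" "j \<le> card A"
  obtains c where "coeff (root_poly A) j = c * coeff (root_poly (inverse ` A)) (card A + 1 - j)"
proof -
  define A' where "A' = A - {0}"
  define c where "c = (\<Prod>a\<in>A'. - a)"
  have card_A: "card A = Suc (card A')"
    using A by (metis A'_def card.remove)
  have f: "root_poly A = pCons 0 (root_poly A')"
    using A by (simp add: root_poly_def A'_def prod.remove)
  have "inverse ` A = insert 0 (inverse ` A')" "0 \<notin> inverse ` A'"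
    using A by (auto simp: A'_def)
  then have h: "root_poly (inverse ` A) = pCons 0 (root_poly (inverse ` A'))"
    using A by (simp add: root_poly_def A'_def)
  \<comment> \<open>Reversal turns x - a into 1 - a x = -a (x - 1/a), inverting the roots.\<close>
  have "reflect_poly (root_poly A') = (\<Prod>a\<in>A'. [:1, - a:])"
    unfolding root_poly_def reflect_poly_prod
    by (rule prod.cong) (auto simp: A'_def reflect_poly_def)
  also have "\<dots> = (\<Prod>a\<in>A'. smult (- a) [:- inverse a, 1:])"
    by (rule prod.cong) (auto simp: A'_def)
  also have "\<dots> = smult c (\<Prod>a\<in>A'. [:- inverse a, 1:])"
    unfolding c_def by (rule prod_smult)
  also have "\<dots> = smult c (root_poly (inverse ` A'))"
    by (simp add: root_poly_def prod.reindex inj_on_def)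
  finally have "coeff (reflect_poly (root_poly A')) (card A - j) =
      c * coeff (root_poly (inverse ` A')) (card A - j)"
    by simp
  \<comment> \<open>The factor x for the root 0 shifts the index on each side by one.\<close>
  then have "coeff (root_poly A) j = c * coeff (root_poly (inverse ` A)) (card A + 1 - j)"
    using j unfolding f h coeff_reflect_poly degree_root_poly card_A
    by (cases j) (auto simp: Suc_diff_le split: if_splits)
  then show thesis
    by (rule that)
qed

text \<open>The q elements of the subfield are roots of x^q - x, which has at most q roots.\<close>

lemma subfield_of_order_eq:
  assumes q: "primepow q" and card: "CARD('a::finite_field) = q ^ 2"
  shows "is_subfield (subfield_of_order q :: 'a set)" "card (subfield_of_order q :: 'a set) = q"
    "subfield_of_order q = {x :: 'a. x ^ q = x}"
proof -
  let ?K = "subfield_of_order q :: 'a set"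
  show K: "is_subfield ?K" "card ?K = q"
    using theI'[OF ex1_subfield_of_order[OF q card]] by (auto simp: subfield_of_order_def)
  have q1: "q > 1"
    using primepow_gt_Suc_0[OF q] by simp
  have deg: "degree (monom 1 q - [:0, 1:] :: 'a poly) = q"
    using q1 by (subst diff_conv_add_uminus, subst degree_add_eq_left) (auto simp: degree_monom_eq)
  then have "card {x :: 'a. poly (monom 1 q - [:0, 1:]) x = 0} \<le> q"
    using card_poly_roots_bound[of "monom 1 q - [:0, 1:] :: 'a poly"] q1 by force
  then have "card {x :: 'a. x ^ q = x} \<le> q"
    by (simp add: poly_monom)
  moreover have "?K \<subseteq> {x. x ^ q = x}"
    using subfield_power_card_eq_same[OF K(1)] K(2) by auto
  ultimately show "?K = {x. x ^ q = x}"
    using K(2) by (intro card_seteq) auto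
qed

lemma eq_subfield_of_order:
  fixes A :: "'a::finite_field set"
  assumes q: "primepow q" and card: "CARD('a) = q ^ 2"
    and A: "card A = q" "0 \<in> A" "1 \<in> A"
    and gap: "\<And>D j. \<lbrakk>D \<in> {A, inverse ` A}; q < 2 * j; j < q\<rbrakk> \<Longrightarrow> coeff (root_poly D) j = 0"
  shows "A = subfield_of_order q"
proof -
  have q1: "q > 1"
    using primepow_gt_Suc_0[OF q] by simp
  let ?f = "root_poly A"
  have mid: "coeff ?f j = 0" if j: "2 \<le> j" "j < q" for j
  proof (cases "q < 2 * j")
    case True
    then show ?thesis
      using gap j by blast
  next
    case False
    obtain c where "coeff ?f j = c * coeff (root_poly (inverse ` A)) (q + 1 - j)"
      using coeff_root_poly_inverse[of A j] A j by auto
    moreover have "coeff (root_poly (inverse ` A)) (q + 1 - j) = 0"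
      by (rule gap) (use False j in auto)
    ultimately show ?thesis
      by simp
  qed
  have c0: "coeff ?f 0 = 0"
    using poly_root_poly_eq_0[of A 0] A by (simp add: poly_0_coeff_0)
  have f: "?f = monom 1 q + [:0, coeff ?f 1:]"
  proof (rule poly_eqI)
    fix j
    consider "j = 0" | "j = 1" | "2 \<le> j" "j < q" | "j = q" | "j > q"
      by linarith
    then show "coeff ?f j = coeff (monom 1 q + [:0, coeff ?f 1:]) j"
      using c0 q1 mid[of j] monic_root_poly[of A] A(1) degree_root_poly[of A]
      by cases (auto simp: coeff_pCons coeff_eq_0 split: nat.split)
  qed
  have val: "poly ?f x = x ^ q + coeff ?f 1 * x" for x
    by (subst f) (simp add: poly_monom mult.commute)
  have "coeff ?f 1 = - 1"
    using poly_root_poly_eq_0[of A 1] A val[of 1] by (simp add: eq_neg_iff_add_eq_0 add.commute)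
  then have "x ^ q = x" if "x \<in> A" for x
    using poly_root_poly_eq_0[of A x] that val[of x] by simp
  then have "A \<subseteq> subfield_of_order q"
    unfolding subfield_of_order_eq(3)[OF q card] by auto
  then show ?thesis
    using subfield_of_order_eq(2)[OF q card] A(1) by (intro card_subset_eq) auto
qed

section \<open>From the size hypotheses on \<open>S\<close> to the gaps\<close>

lemma eq_subfield_of_order_of_difference_set:
  fixes q :: nat and S :: "'a::finite_field set"
  assumes q: "primepow q" and card: "CARD('a) = q ^ 2"
    and small: "real (card (S * S * S * (inverse ` S) * (inverse ` S) * (inverse ` S))) \<le> (real q ^ 2 - 3) / 2
      \<or> real (card (S * (inverse ` S) * (inverse ` S) * (subfield_of_order q - {0}))) \<le> (real q ^ 2 - 1) / 2"
    and A: "card A = q" "0 \<in> A" "1 \<in> A" "difference_set A A \<subseteq> S \<union> {0}"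
  shows "A = subfield_of_order q"
proof -
  have q1: "q > 1"
    using primepow_gt_Suc_0[OF q] by simp
  have diff: "a - b \<in> S" if "a \<in> A" "b \<in> A" "a \<noteq> b" for a b
    using A(4) that by (fastforce simp: difference_set_def)
  have one: "1 \<in> S"
    using diff[of 1 0] A by simp
  have one': "1 \<in> inverse ` S"
    using one by force
  define U where "U = S * inverse ` S * inverse ` S"
  have diff_U: "d - d' \<in> U" if "D \<in> {A, inverse ` A}" "d \<in> D" "d' \<in> D" "d \<noteq> d'" for D d d'
  proof (cases "D = A")
    case True
    then have "(d - d') * 1 * 1 \<in> U"
      unfolding U_def using that one' diff by (intro set_times_intro) auto
    then show ?thesis
      by simp
  next
    case False
    then have "d \<in> inverse ` A" "d' \<in> inverse ` A"
      using that by auto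
    then obtain a b where ab: "a \<in> A" "b \<in> A" "a \<noteq> b" "d = inverse a" "d' = inverse b"
      using \<open>d \<noteq> d'\<close> by blast
    show ?thesis
    proof (cases "a = 0 \<or> b = 0")
      case True
      \<comment> \<open>As \<open>inverse 0 = 0\<close>, the case a = 0 gives -1/b = 1/(0 - b), and
        b = 0 gives 1/(a - 0).\<close>
      then have "d - d' = 1 * inverse (a - b) * 1"
        using ab by auto
      also have "\<dots> \<in> U"
        unfolding U_def using ab one one' diff by (intro set_times_intro) auto
      finally show ?thesis .
    next
      case False
      then have "d - d' = (b - a) * inverse a * inverse b"
        using ab by (simp add: field_simps)
      also have "\<dots> \<in> U"
        unfolding U_def using ab diff[of b a] diff[of a 0] diff[of b 0] False A(2)
        by (intro set_times_intro) auto
      finally show ?thesis .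
    qed
  qed
  show ?thesis
  proof (rule eq_subfield_of_order[OF q card A(1-3)])
    fix D j assume D: "D \<in> {A, inverse ` A}" and j: "q < 2 * j" "j < q"
    have card_D: "card D = q"
      using D A(1) by (auto simp: card_image inj_on_def)
    from small show "coeff (root_poly D) j = 0"
    proof
      let ?T = "S * S * S * inverse ` S * inverse ` S * inverse ` S"
      assume "real (card ?T) \<le> (real q ^ 2 - 3) / 2"
      then have "real (2 * card ?T) \<le> real (q ^ 2 - 1)"
        using q1 by (simp add: of_nat_diff)
      then have T: "2 * card ?T \<le> q ^ 2 - 1"
        by linarith
      have U_ratio: "u / v \<in> ?T" if "u \<in> U" "v \<in> U" for u v
      proof -
        obtain r s t where u: "u = r * inverse s * inverse t" "r \<in> S" "s \<in> S" "t \<in> S"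
          using \<open>u \<in> U\<close> unfolding U_def by (auto elim!: set_times_elim)
        obtain r' s' t' where v: "v = r' * inverse s' * inverse t'" "r' \<in> S" "s' \<in> S" "t' \<in> S"
          using \<open>v \<in> U\<close> unfolding U_def by (auto elim!: set_times_elim)
        have "u / v = r * s' * t' * inverse s * inverse t * inverse r'"
          using u v by (simp add: field_simps)
        also have "\<dots> \<in> ?T"
          using u v by (intro set_times_intro) auto
        finally show ?thesis .
      qed
      show ?thesis
        by (rule coeff_root_poly_eq_0[OF q card card_D card_D T _ j])
           (intro U_ratio diff_U[OF D])
    next
      let ?K = "subfield_of_order q :: 'a set"
      let ?T = "S * inverse ` S * inverse ` S * (?K - {0})"
      note K = subfield_of_order_eq(1,2)[OF q card]
      assume "real (card ?T) \<le> (real q ^ 2 - 1) / 2"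
      then have "real (2 * card ?T) \<le> real (q ^ 2 - 1)"
        using q1 by (simp add: of_nat_diff)
      then have T: "2 * card ?T \<le> q ^ 2 - 1"
        by linarith
      \<comment> \<open>With \<open>B\<close> the subfield, division by a difference is
        multiplication by an element of \<open>?K - {0}\<close>.\<close>
      have K_diff: "inverse (b - b') \<in> ?K - {0}" if "b \<in> ?K" "b' \<in> ?K" "b \<noteq> b'" for b b'
      proof -
        have "b + - b' \<in> ?K"
          using K(1) that unfolding is_subfield_def by blast
        then show ?thesis
          using K(1) that unfolding is_subfield_def by auto
      qed
      show ?thesis
      proof (rule coeff_root_poly_eq_0[OF q card card_D K(2) T _ j])
        fix d d' b b' assume "d \<in> D" "d' \<in> D" "b \<in> ?K" "b' \<in> ?K" "d \<noteq> d'" "b \<noteq> b'"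
        then show "(d - d') / (b - b') \<in> ?T"
          unfolding divide_inverse U_def[symmetric] using D
          by (intro set_times_intro diff_U K_diff)
      qed
    qed
  qed
qed

theorem theorem1p1:
  fixes q :: nat and S :: "'a::finite_field set"
  assumes "primepow q"
    and "CARD('a) = q ^ 2"
    and "S \<subseteq> UNIV - {0}"
    and "S = uminus ` S"
    and "real (card (S * S * S * (inverse ` S) * (inverse ` S) * (inverse ` S))) \<le> (real q ^ 2 - 3) / 2
      \<or> real (card (S * (inverse ` S) * (inverse ` S) * (subfield_of_order q - {0}))) \<le> (real q ^ 2 - 1) / 2"
  shows "(\<forall>A. card A = q \<and> 0 \<in> A \<and> 1 \<in> A \<and> difference_set A A \<subseteq> S \<union> {0}
            \<longrightarrow> A = subfield_of_order q)
       \<and> (\<forall>A. card A = q \<and> 0 \<in> A \<and> 1 \<in> A \<and> clique A (cayley_edges S)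
            \<longrightarrow> A = subfield_of_order q)"
  unfolding clique_cayley_edges_iff[OF assms(4)]
  using eq_subfield_of_order_of_difference_set[OF assms(1,2,5)] by blast

end
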